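(* Let $F:[0,\infty)\to\mathbb{R}$ be defined by $$F(x)=\begin{cases}\dfrac{\ln\Gamma(x+1)}{\ln(x^2+1)-\ln(x+1)}, & x\ne 0,1,\\[2mm] \gamma, & x=0,\\ 2(1-\gamma), & x=1.\end{cases}$$ Then $F$ is strictly increasing on $[0,\infty)$.
   Context: $\Gamma(x)=\int_0^\infty t^{x-1}e^{-t}\,dt$ for $x>0$ is Euler's gamma function, $\ln$ is the natural logarithm, and $\gamma$ is the Euler–Mascheroni constant. *)

theory Defs
  imports "HOL-Analysis.Analysis"
begin

(* Only the values on {0..} are meant; the formula is also given a meaning for
   negative arguments because functions are total. *)
definition F :: "real \<Rightarrow> real" where
  "F x = (if x = 0 then euler_mascheroni
          else if x = 1 then 2 * (1 - euler_mascheroni)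
          else ln (Gamma (x + 1)) / (ln (x\<^sup>2 + 1) - ln (x + 1)))"

end

theory Submission
  imports Defs "HOL-Real_Asymp.Real_Asymp"
begin

text \<open>
  For a constant \<open>c\<close> put \<open>h x = ln (Gamma (x + 1)) - c * (ln (x\<^sup>2 + 1) - ln (x + 1))\<close>. Whenever
  \<open>F x = c\<close>, the function \<open>h\<close> vanishes at \<open>x\<close>, and doubly so if \<open>x\<close> is one of its trivial zeros
  0 and 1. Hence two solutions of \<open>F x = c\<close> give \<open>h\<close> four zeros with multiplicity, so by Rolle
  \<open>h''\<close> has two distinct zeros. But for \<open>c \<ge> \<gamma>\<close> it has at most one: up to a positive factor,
  \<open>h''\<close> is \<open>(1 + x)\<^sup>2 Polygamma 1 (1 + x) - c * E x\<close> with an increasing first term and a rational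
  function \<open>E\<close> that is too large for a zero when \<open>x \<le> 3/10\<close>, decreasing on \<open>[3/10, 2]\<close>,
  and nonpositive afterwards. The case \<open>c = \<gamma> = F 0\<close> shows by continuity that \<open>F \<ge> \<gamma>\<close>
  everywhere, so that all values of \<open>F\<close> are covered and \<open>F\<close> is injective. A continuous injective
  function on an interval is strictly monotone, and \<open>F 0 < F 1\<close>.
\<close>

subsection \<open>The trigamma function\<close>

lemma Trigamma_sums:
  fixes y :: real
  assumes "y > 0"
  shows "(\<lambda>k. 1 / (y + real k)\<^sup>2) sums Polygamma 1 y"
proof -
  have "summable (\<lambda>k. inverse ((y + real k)^2))"
    using assms by (intro Polygamma_converges') auto
  thus ?thesis
    by (simp add: Polygamma_def summable_sums inverse_eq_divide numeral_2_eq_2)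
qed

text \<open>The bound is a truncated asymptotic expansion \<open>f\<close>. Its decrement
  \<open>f t - f (t + 1)\<close> exceeds \<open>1 / t\<^sup>2\<close>, so the series is dominated by
  a telescoping one.\<close>

lemma Trigamma_upper:
  fixes y :: real
  assumes "y > 0"
  shows "Polygamma 1 y \<le> 1 / y + 1 / (2 * y\<^sup>2) + 1 / (6 * y ^ 3)"
proof -
  define f where "f = (\<lambda>t::real. 1 / t + 1 / (2 * t\<^sup>2) + 1 / (6 * t ^ 3))"
  have le: "1 / t\<^sup>2 \<le> f t - f (t + 1)" if "t > 0" for t
  proof -
    \<comment> \<open>A free \<open>s\<close> keeps the denominator factored; at
      \<open>s = t + 1\<close> the numerator collapses to 1.\<close>
    have "f t - f s - 1 / t\<^sup>2 =
        (6 * t\<^sup>2 * s ^ 3 + 3 * t * s ^ 3 + s ^ 3 - 6 * t ^ 3 * s\<^sup>2 - 3 * t ^ 3 * s - t ^ 3 - 6 * t * s ^ 3)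
          / (6 * t ^ 3 * s ^ 3)" if "s > 0" for s
      using that \<open>t > 0\<close> unfolding f_def by (simp add: field_simps power2_eq_square power3_eq_cube)
    from this[of "t + 1"] have "f t - f (t + 1) - 1 / t\<^sup>2 = 1 / (6 * t ^ 3 * (t + 1) ^ 3)"
      using that by (simp add: algebra_simps power2_eq_square power3_eq_cube)
    moreover have "\<dots> \<ge> 0" using that by simp
    ultimately show ?thesis by linarith
  qed
  have "(\<lambda>k. f (y + real k)) \<longlonglongrightarrow> 0"
    unfolding f_def by real_asymp
  hence "(\<lambda>k. f (y + real k) - f (y + real (Suc k))) sums (f (y + real 0) - 0)"
    by (rule telescope_sums')
  hence "Polygamma 1 y \<le> f y - 0"
    using le[of "y + real k" for k] assms
    by (intro sums_le[OF _ Trigamma_sums[OF assms]]) (auto simp: add_ac)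
  thus ?thesis by (simp add: f_def)
qed

lemma square_mult_Trigamma_strict_mono:
  fixes a b :: real
  assumes "0 < a" "a < b"
  shows "a\<^sup>2 * Polygamma 1 a < b\<^sup>2 * Polygamma 1 b"
proof -
  let ?d = "\<lambda>k. b\<^sup>2 * (1 / (b + real k)\<^sup>2) - a\<^sup>2 * (1 / (a + real k)\<^sup>2)"
  have sums: "?d sums (b\<^sup>2 * Polygamma 1 b - a\<^sup>2 * Polygamma 1 a)"
    using assms by (intro sums_diff sums_mult Trigamma_sums) auto
  have d: "?d k = (b / (b + real k))\<^sup>2 - (a / (a + real k))\<^sup>2" for k
    by (simp add: power_divide)
  have "a / (a + real k) \<le> b / (b + real k)" for k
    using assms by (simp add: divide_simps algebra_simps mult_right_mono)
  hence "?d k \<ge> 0" for k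
    using assms unfolding d by (auto intro!: power_mono divide_nonneg_nonneg)
  \<comment> \<open>The summand for k = 0 vanishes, so strictness must come from k = 1.\<close>
  moreover have "a / (a + real 1) < b / (b + real 1)"
    using assms by (simp add: divide_simps algebra_simps)
  hence "?d 1 > 0"
    using assms unfolding d by (simp add: power_strict_mono)
  ultimately have "suminf ?d > 0"
    using sums_summable[OF sums] by (intro suminf_pos2)
  thus ?thesis using sums_unique[OF sums] by simp
qed


subsection \<open>The denominator\<close>

definition denom :: "real \<Rightarrow> real" where
  "denom x = ln (x\<^sup>2 + 1) - ln (x + 1)"

definition denom' :: "real \<Rightarrow> real" where
  "denom' x = 2 * x / (x\<^sup>2 + 1) - 1 / (x + 1)"

text \<open>This is \<open>(1 + x)\<^sup>2\<close> times the second derivative of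
  \<open>denom\<close>; the factor is the one that makes the trigamma term increasing.\<close>

definition E :: "real \<Rightarrow> real" where
  "E x = 1 + 2 * ((1 - x) * (1 + x) ^ 3 / (1 + x\<^sup>2)\<^sup>2)"

lemma square_plus_1_pos: "x\<^sup>2 + 1 > (0::real)"
  by (simp add: add_nonneg_pos)

lemma denom_has_derivative:
  assumes "x \<ge> 0"
  shows "(denom has_real_derivative denom' x) (at x)"
  unfolding denom_def[abs_def] denom'_def using assms square_plus_1_pos[of x]
  by (auto intro!: derivative_eq_intros)

lemma denom'_has_derivative:
  assumes "x \<ge> 0"
  shows "(denom' has_real_derivative E x / (1 + x)\<^sup>2) (at x)"
proof -
  have nz: "x\<^sup>2 + 1 \<noteq> 0" "x + 1 \<noteq> 0" "1 + x\<^sup>2 \<noteq> 0" "1 + x \<noteq> 0"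
    using assms square_plus_1_pos[of x] by auto
  have "(denom' has_real_derivative (2 * (x\<^sup>2 + 1) - 2 * x * (2 * x)) / (x\<^sup>2 + 1)\<^sup>2 + 1 / (x + 1)\<^sup>2) (at x)"
    unfolding denom'_def[abs_def] using nz
    by (auto intro!: derivative_eq_intros simp: power2_eq_square)
  also have "(2 * (x\<^sup>2 + 1) - 2 * x * (2 * x)) / (x\<^sup>2 + 1)\<^sup>2 + 1 / (x + 1)\<^sup>2 = E x / (1 + x)\<^sup>2"
    unfolding E_def using nz
    by (simp add: add.commute[of _ 1] divide_simps) (simp add: algebra_simps power2_eq_square power3_eq_cube)
  finally show ?thesis .
qed

lemma denom_eq_0_iff:
  assumes "x \<ge> 0"
  shows "denom x = 0 \<longleftrightarrow> x = 0 \<or> x = 1"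
  using assms square_plus_1_pos[of x] by (auto simp: denom_def power2_eq_square)

lemma E_lower:
  assumes "0 \<le> x" "x \<le> 3/10"
  shows "E x \<ge> 3 + 3/2 * x"
proof -
  have "x^3 \<le> (3/10)^3" "x^4 \<le> (3/10)^4" "x^2 \<le> (3/10)^2"
    using assms by (auto intro!: power_mono)
  \<comment> \<open>All nonconstant coefficients are negative, so the worst case is x =
    3/10.\<close>
  hence "0 \<le> 5/4 - 2 * x - 7/2 * x^2 - 2 * x^3 - 3/4 * x^4"
    using assms by (simp add: power_divide)
  hence "0 \<le> x * (5/4 - 2 * x - 7/2 * x^2 - 2 * x^3 - 3/4 * x^4)"
    using assms by simp
  also have "\<dots> = (1 - x) * (1 + x) ^ 3 - (1 + 3/4 * x) * (1 + x\<^sup>2)\<^sup>2"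
    by (simp add: algebra_simps power2_eq_square power3_eq_cube power4_eq_xxxx)
  finally have "1 + 3/4 * x \<le> (1 - x) * (1 + x) ^ 3 / (1 + x\<^sup>2)\<^sup>2"
    using square_plus_1_pos[of x] by (subst pos_le_divide_eq) (auto simp: add.commute)
  thus ?thesis by (simp add: E_def)
qed

text \<open>The sign of the derivative is that of \<open>x\<^sup>2 - 4 * x + 1\<close>, whose roots
  are 2 - sqrt 3 < 3/10 and 2 + sqrt 3 > 2.\<close>

lemma E_strict_antimono:
  assumes "3/10 \<le> a" "a < b" "b \<le> 2"
  shows "E b < E a"
proof (rule DERIV_neg_imp_decreasing[OF \<open>a < b\<close>], intro exI conjI)
  fix x assume x: "a \<le> x" "x \<le> b"
  have nz: "1 + x\<^sup>2 > 0" using square_plus_1_pos[of x] by (simp add: add.commute)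
  let ?y = "1 + x" and ?u = "1 + x\<^sup>2"
  let ?E' = "4 * ?y\<^sup>2 * (x\<^sup>2 - 4 * x + 1) / ?u ^ 3"
  have "(E has_real_derivative
      2 * (((3 * ?y\<^sup>2 * (1 - x) - ?y ^ 3) * ?u\<^sup>2 - (1 - x) * ?y ^ 3 * (2 * ?u * (2 * x))) / (?u\<^sup>2 * ?u\<^sup>2))) (at x)"
    unfolding E_def[abs_def] using nz
    by (auto intro!: derivative_eq_intros simp: algebra_simps)
  also have "(3 * ?y\<^sup>2 * (1 - x) - ?y ^ 3) * ?u\<^sup>2 - (1 - x) * ?y ^ 3 * (2 * ?u * (2 * x))
      = ?u * (2 * ?y\<^sup>2 * (x\<^sup>2 - 4 * x + 1))"
    by algebra
  also have "2 * (?u * (2 * ?y\<^sup>2 * (x\<^sup>2 - 4 * x + 1)) / (?u\<^sup>2 * ?u\<^sup>2)) = ?E'"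
    using nz by (simp add: divide_simps) (simp add: power2_eq_square power3_eq_cube power4_eq_xxxx)
  finally show "(E has_real_derivative ?E') (at x)" .
  \<comment> \<open>Bounding the square by its chord over [3/10, 2] makes the sign condition
    linear.\<close>
  have "(x - 3/10) * (x - 2) \<le> 0"
    using x assms by (intro mult_nonneg_nonpos) auto
  hence "x\<^sup>2 \<le> 23/10 * x - 6/10"
    by (simp add: field_simps power2_eq_square)
  hence "x\<^sup>2 - 4 * x + 1 < 0"
    using x assms by linarith
  thus "?E' < 0"
    using nz x assms by (intro divide_neg_pos mult_pos_neg) auto
qed

lemma E_nonpos:
  assumes "x \<ge> 2"
  shows "E x \<le> 0"
proof -
  have "x\<^sup>2 \<ge> 2\<^sup>2" using assms by (intro power_mono) auto
  hence "(1 + x\<^sup>2)\<^sup>2 \<le> (x * (1 + x))\<^sup>2"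
    using assms by (intro power_mono) (auto simp: power2_eq_square algebra_simps)
  also have "\<dots> = x\<^sup>2 * (1 + x)\<^sup>2"
    by (simp add: power_mult_distrib)
  also have "\<dots> \<le> (2 * x\<^sup>2 - 2) * (1 + x)\<^sup>2"
    using \<open>x\<^sup>2 \<ge> 2\<^sup>2\<close> by (intro mult_right_mono) auto
  also have "\<dots> = 2 * (x - 1) * (1 + x) ^ 3"
    by (simp add: algebra_simps power2_eq_square power3_eq_cube)
  finally have "(1 + x\<^sup>2)\<^sup>2 \<le> 2 * (x - 1) * (1 + x) ^ 3" .
  hence "(1 - x) * (1 + x) ^ 3 / (1 + x\<^sup>2)\<^sup>2 \<le> - 1 / 2"
    using square_plus_1_pos[of x]
    by (subst pos_divide_le_eq) (auto simp: add.commute algebra_simps)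
  thus ?thesis by (simp add: E_def)
qed


subsection \<open>The second derivative has at most one zero\<close>

lemma Trigamma_less_E:
  assumes "0 \<le> x" "x \<le> 3/10"
  shows "(1 + x)\<^sup>2 * Polygamma 1 (1 + x) < euler_mascheroni * E x"
proof -
  have eq: "y\<^sup>2 * (1 / y + 1 / (2 * y\<^sup>2) + 1 / (6 * y ^ 3)) = y + 1 / 2 + 1 / (6 * y)"
    if "y > 0" for y :: real
    using that by (simp add: field_simps power2_eq_square power3_eq_cube)
  have "(1 + x)\<^sup>2 * Polygamma 1 (1 + x) \<le>
      (1 + x)\<^sup>2 * (1 / (1 + x) + 1 / (2 * (1 + x)\<^sup>2) + 1 / (6 * (1 + x) ^ 3))"
    using assms by (intro mult_left_mono Trigamma_upper) auto
  also have "\<dots> = (1 + x) + 1 / 2 + 1 / (6 * (1 + x))"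
    using assms by (intro eq) auto
  also have "\<dots> \<le> (1 + x) + 1 / 2 + 1 / 6"
    using assms by (intro add_left_mono divide_left_mono) auto
  \<comment> \<open>Both sides are linear in x and the gap is smallest at x = 3/10, where it is
    still positive.\<close>
  also have "\<dots> < 19/33 * (3 + 3/2 * x)"
    using assms by simp
  also have "\<dots> \<le> euler_mascheroni * E x"
    using assms E_lower[OF assms] euler_mascheroni_gt_19_over_33 by (intro mult_mono) auto
  finally show ?thesis .
qed

text \<open>Positivity of trigamma forces \<open>E > 0\<close> at a solution, hence x < 2, and
  \<open>Trigamma_less_E\<close> excludes x \<le> 3/10. In between, the left side increases while
  \<open>E\<close> decreases.\<close>

lemma Trigamma_eq_E_unique:
  assumes "0 \<le> a" "a < b" "c \<ge> euler_mascheroni"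
    and "(1 + a)\<^sup>2 * Polygamma 1 (1 + a) = c * E a" "(1 + b)\<^sup>2 * Polygamma 1 (1 + b) = c * E b"
  shows False
proof -
  have c: "c > 0" using assms(3) euler_mascheroni_pos by linarith
  have range: "3/10 < x \<and> x < 2"
    if x: "x \<ge> 0" "(1 + x)\<^sup>2 * Polygamma 1 (1 + x) = c * E x" for x
  proof -
    have "Polygamma 1 (1 + x) > 0"
      using x by (intro Polygamma_real_odd_pos) (auto elim!: nonpos_Ints_cases)
    hence "c * E x > 0"
      using x by (metis add_pos_nonneg mult_pos_pos zero_less_one zero_less_power)
    hence "E x > 0" using c by (simp add: zero_less_mult_iff)
    moreover have "x > 3/10"
    proof (rule ccontr)
      assume "\<not> x > 3/10"
      hence "c * E x < euler_mascheroni * E x"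
        using Trigamma_less_E[of x] x by auto
      thus False using \<open>E x > 0\<close> assms(3) by simp
    qed
    ultimately show ?thesis using E_nonpos[of x] by force
  qed
  have "c * E a < c * E b"
    using square_mult_Trigamma_strict_mono[of "1 + a" "1 + b"] assms by simp
  moreover have "E b < E a"
    using range[of a] range[of b] assms by (intro E_strict_antimono) auto
  ultimately show False using c by simp
qed

lemma Rolle_nonneg:
  fixes f f' :: "real \<Rightarrow> real"
  assumes "\<And>x. x \<ge> 0 \<Longrightarrow> (f has_real_derivative f' x) (at x)"
    and "0 \<le> a" "a < b" "f a = f b"
  obtains z where "a < z" "z < b" "f' z = 0"
proof -
  have "f differentiable (at x)" if "a < x" for x
    using assms(1)[of x] assms(2) that by (auto simp: real_differentiable_def)
  hence "\<exists>z. a < z \<and> z < b \<and> (f has_real_derivative 0) (at z)"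
    using assms(2-4)
    by (intro Rolle continuous_at_imp_continuous_on) (auto intro!: DERIV_isCont[OF assms(1)])
  then obtain z where z: "a < z" "z < b" "(f has_real_derivative 0) (at z)"
    by blast
  thus ?thesis
    using DERIV_unique[OF assms(1)[of z]] assms(2) that by auto
qed

lemma lnGamma_has_derivative:
  fixes x :: real
  assumes "x \<ge> 0"
  shows "((\<lambda>x. ln_Gamma (x + 1)) has_real_derivative Digamma (x + 1)) (at x)"
  using assms by (auto intro!: derivative_eq_intros)

lemma Digamma_has_derivative:
  fixes x :: real
  assumes "x \<ge> 0"
  shows "((\<lambda>x. Digamma (x + 1)) has_real_derivative Polygamma 1 (1 + x)) (at x)"
  using assms by (auto intro!: derivative_eq_intros simp: add.commute elim!: nonpos_Ints_cases)

lemma first_derivative_three_zeros: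
  assumes "0 \<le> u" "u < v" "v < w" "c \<ge> euler_mascheroni"
    and zeros: "\<And>x. x \<in> {u, v, w} \<Longrightarrow> Digamma (x + 1) = c * denom' x"
  shows False
proof -
  let ?h' = "\<lambda>x. Digamma (x + 1) - c * denom' x"
  let ?h'' = "\<lambda>x. Polygamma 1 (1 + x) - c * (E x / (1 + x)\<^sup>2)"
  have deriv: "(?h' has_real_derivative ?h'' x) (at x)" if "x \<ge> 0" for x
    using that by (intro DERIV_diff DERIV_cmult Digamma_has_derivative denom'_has_derivative)
  obtain a where a: "u < a" "a < v" "?h'' a = 0"
    using Rolle_nonneg[of ?h' ?h'' u v, OF deriv] assms by auto
  obtain b where b: "v < b" "b < w" "?h'' b = 0"
    using Rolle_nonneg[of ?h' ?h'' v w, OF deriv] assms by auto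
  have "(1 + x)\<^sup>2 * Polygamma 1 (1 + x) = c * E x" if "x > 0" "?h'' x = 0" for x
    using that by (simp add: field_simps)
  thus False
    using Trigamma_eq_E_unique[of a b c] a b assms by auto
qed


subsection \<open>Level sets of F\<close>

lemma F_eq:
  assumes "x \<ge> 0" "x \<noteq> 0" "x \<noteq> 1"
  shows "F x = ln_Gamma (x + 1) / denom x"
  using assms by (simp add: F_def denom_def ln_Gamma_real_pos)

lemma Digamma_2: "Digamma 2 = 1 - (euler_mascheroni :: real)"
  using Digamma_numeral[of "Num.Bit0 num.One", where 'a = real] by (simp add: harm_expand)

lemma F_level_simple:
  assumes "x \<ge> 0" "F x = c"
  shows "ln_Gamma (x + 1) = c * denom x"
proof (cases "x = 0 \<or> x = 1")
  case True
  thus ?thesis using ln_Gamma_real_pos[of 1] ln_Gamma_real_pos[of 2] Gamma_numeral[of "num.Bit0 num.One", where 'a = real]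
    by (auto simp: denom_def)
next
  case False
  thus ?thesis using assms F_eq[of x] denom_eq_0_iff[of x] by (auto simp: field_simps)
qed

text \<open>The special values of \<open>F\<close> are the l'Hopital quotients
  \<open>Digamma (x + 1) / denom' x\<close>, which makes 0 or 1 a double zero of \<open>h\<close>
  when the level is attained there.\<close>

lemma F_level_double:
  assumes "x \<in> {0, 1}" "F x = c"
  shows "Digamma (x + 1) = c * denom' x"
  using assms Digamma_2 by (auto simp: F_def denom'_def)

text \<open>\<open>h\<close> vanishes at 0, 1, x and y. Each gap between neighbouring distinct
  points gives a zero of \<open>h'\<close> by Rolle, and each coincidence with 0 or 1 gives one at
  the point itself: three in every case.\<close>

lemma F_level_unique:
  assumes "0 \<le> x" "x < y" "F x = c" "F y = c" "c \<ge> euler_mascheroni"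
  shows False
proof -
  let ?h = "\<lambda>x. ln_Gamma (x + 1) - c * denom x"
  define Z where "Z = (\<lambda>x. Digamma (x + 1) = c * denom' x)"
  have deriv: "(?h has_real_derivative (Digamma (x + 1) - c * denom' x)) (at x)" if "x \<ge> 0" for x
    using that by (intro DERIV_diff DERIV_cmult lnGamma_has_derivative denom_has_derivative)
  have zero: "ln_Gamma (t + 1) = c * denom t" if "t \<in> {0, 1, x, y}" for t
    using that F_level_simple[of t c] F_level_simple[of t "F t"] assms
    by (auto simp: denom_def)
  have between: "\<exists>z. a < z \<and> z < b \<and> Z z" if "a < b" "{a, b} \<subseteq> {0, 1, x, y}" for a b
    using Rolle_nonneg[of ?h "\<lambda>x. Digamma (x + 1) - c * denom' x" a b, OF deriv] that zero[of a] zero[of b] assms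
    unfolding Z_def by (smt (verit) empty_iff insert_iff insert_subset)
  have at: "Z x" if "x \<in> {0, 1}" using F_level_double that assms unfolding Z_def by blast
  have at': "Z y" if "y \<in> {0, 1}" using F_level_double that assms unfolding Z_def by blast
  have three_zeros: False if "0 \<le> u" "u < v" "v < w" "Z u" "Z v" "Z w" for u v w
    using first_derivative_three_zeros[of u v w c] that assms unfolding Z_def by auto
  consider "x = 0" "y = 1" | "x = 0" "0 < y" "y < 1" | "x = 0" "y > 1"
    | "0 < x" "y < 1" | "0 < x" "x < 1" "y = 1" | "0 < x" "x < 1" "y > 1"
    | "x = 1" | "x > 1"
    using assms by linarith
  thus ?thesis
  proof cases
    case 1
    obtain p where p: "0 < p" "p < 1" "Z p" using between[of 0 1] 1 by auto
    thus ?thesis using three_zeros[of 0 p 1] p 1 at at' by auto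
  next
    case 2
    obtain p where p: "0 < p" "p < y" "Z p" using between[of 0 y] 2 by auto
    obtain q where q: "y < q" "q < 1" "Z q" using between[of y 1] 2 by auto
    thus ?thesis using three_zeros[of 0 p q] p q 2 at at' by auto
  next
    case 3
    obtain p where p: "0 < p" "p < 1" "Z p" using between[of 0 1] 3 by auto
    obtain q where q: "1 < q" "q < y" "Z q" using between[of 1 y] 3 by auto
    thus ?thesis using three_zeros[of 0 p q] p q 3 at at' by auto
  next
    case 4
    obtain p where p: "0 < p" "p < x" "Z p" using between[of 0 x] 4 assms by auto
    obtain q where q: "x < q" "q < y" "Z q" using between[of x y] 4 assms by auto
    obtain r where r: "y < r" "r < 1" "Z r" using between[of y 1] 4 assms by auto
    thus ?thesis using three_zeros[of p q r] p q r 4 assms at at' by auto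
  next
    case 5
    obtain p where p: "0 < p" "p < x" "Z p" using between[of 0 x] 5 by auto
    obtain q where q: "x < q" "q < 1" "Z q" using between[of x 1] 5 by auto
    thus ?thesis using three_zeros[of p q 1] p q 5 at at' by auto
  next
    case 6
    obtain p where p: "0 < p" "p < x" "Z p" using between[of 0 x] 6 by auto
    obtain q where q: "x < q" "q < 1" "Z q" using between[of x 1] 6 by auto
    obtain r where r: "1 < r" "r < y" "Z r" using between[of 1 y] 6 by auto
    thus ?thesis using three_zeros[of p q r] p q r 6 at at' by auto
  next
    case 7
    obtain p where p: "0 < p" "p < 1" "Z p" using between[of 0 1] 7 assms by auto
    obtain q where q: "1 < q" "q < y" "Z q" using between[of 1 y] 7 assms by auto
    thus ?thesis using three_zeros[of p 1 q] p q 7 assms at at' by auto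
  next
    case 8
    obtain p where p: "0 < p" "p < 1" "Z p" using between[of 0 1] 8 assms by auto
    obtain q where q: "1 < q" "q < x" "Z q" using between[of 1 x] 8 assms by auto
    obtain r where r: "x < r" "r < y" "Z r" using between[of x y] 8 assms by auto
    thus ?thesis using three_zeros[of p q r] p q r 8 assms at at' by auto
  qed
qed


subsection \<open>Continuity and monotonicity\<close>

text \<open>Dividing numerator and denominator by \<open>x - a\<close> turns the ratio into one of
  difference quotients.\<close>

lemma quotient_tendsto_at_zero:
  fixes f g :: "real \<Rightarrow> real"
  assumes "(f has_real_derivative f') (at a)" "(g has_real_derivative g') (at a)"
    and "f a = 0" "g a = 0" "g' \<noteq> 0"
  shows "((\<lambda>x. f x / g x) \<longlongrightarrow> f' / g') (at a)"
proof -
  have "((\<lambda>x. ((f x - f a) / (x - a)) / ((g x - g a) / (x - a))) \<longlongrightarrow> f' / g') (at a)"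
    using assms by (intro tendsto_divide) (auto simp: has_field_derivative_iff)
  moreover have "eventually (\<lambda>x. ((f x - f a) / (x - a)) / ((g x - g a) / (x - a)) = f x / g x) (at a)"
    using assms by (auto simp: eventually_at_filter)
  ultimately show ?thesis by (rule Lim_transform_eventually)
qed

lemma F_continuous: "continuous_on {0..} F"
  unfolding continuous_on_def
proof
  fix a :: real assume "a \<in> {0..}"
  hence a: "a \<ge> 0" by simp
  let ?q = "\<lambda>x. ln_Gamma (x + 1) / denom x"
  have "(?q \<longlongrightarrow> F a) (at a)"
  proof (cases "a = 0 \<or> a = 1")
    case True
    hence "denom a = 0" "ln_Gamma (a + 1) = 0" "F a = Digamma (a + 1) / denom' a" "denom' a \<noteq> 0"
      using F_level_simple[of a "F a"] F_level_double[of a "F a"]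
      by (auto simp: denom_def denom'_def)
    thus ?thesis
      using quotient_tendsto_at_zero[OF lnGamma_has_derivative[OF a] denom_has_derivative[OF a]]
      by simp
  next
    case False
    have "isCont ?q a"
      using False a denom_eq_0_iff[OF a]
      by (intro continuous_intros DERIV_isCont[OF lnGamma_has_derivative[OF a]]
            DERIV_isCont[OF denom_has_derivative[OF a]]) auto
    thus ?thesis using False a F_eq[of a] by (simp add: isCont_def)
  qed
  hence "(?q \<longlongrightarrow> F a) (at a within {0..})"
    by (rule tendsto_within_subset) auto
  \<comment> \<open>The exceptional points are avoided near \<open>a\<close> even if
    \<open>a\<close> is one of them, since the filter omits \<open>a\<close>.\<close>
  have "eventually (\<lambda>x. x \<noteq> 0 \<and> x \<noteq> 1 \<and> x \<ge> 0) (at a within {0..})"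
    by (intro eventually_conj eventually_neq_at_within) (auto simp: eventually_at_filter)
  hence "eventually (\<lambda>x. ?q x = F x) (at a within {0..})"
    by (rule eventually_mono) (simp add: F_eq)
  with \<open>(?q \<longlongrightarrow> F a) (at a within {0..})\<close> show "(F \<longlongrightarrow> F a) (at a within {0..})"
    by (rule Lim_transform_eventually)
qed

lemma F_0: "F 0 = euler_mascheroni" and F_1: "F 1 = 2 * (1 - euler_mascheroni)"
  by (simp_all add: F_def)

text \<open>This amounts to \<open>euler_mascheroni < 2/3\<close>, and 13/22 < 2/3.\<close>

lemma F_0_less_F_1: "F 0 < F 1"
  using euler_mascheroni_less_13_over_22 by (simp add: F_0 F_1)

lemma F_ge:
  assumes "x \<ge> 0"
  shows "F x \<ge> euler_mascheroni"
proof (rule ccontr)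
  assume less: "\<not> F x \<ge> euler_mascheroni"
  have cont: "continuous_on {a..b} F" if "a \<ge> 0" for a b
    by (rule continuous_on_subset[OF F_continuous]) (use that in auto)
  \<comment> \<open>The level lies between \<open>F x\<close> and \<open>F 1\<close>. The lower
    bound on z keeps it away from 0, so the level \<open>F 0\<close> is attained twice.\<close>
  have "\<exists>z\<ge>min x 1. F z = euler_mascheroni"
  proof (cases "x \<le> 1")
    case True
    thus ?thesis
      using IVT'[of F x euler_mascheroni 1] cont[of x 1] assms less F_0_less_F_1 by (auto simp: F_0)
  next
    case False
    thus ?thesis
      using IVT2'[of F x euler_mascheroni 1] cont[of 1 x] less F_0_less_F_1 by (auto simp: F_0)
  qed
  then obtain z where "min x 1 \<le> z" "F z = euler_mascheroni" by blast
  moreover have "x > 0" using assms less by (auto simp: less_le F_0)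
  hence "min x 1 > 0" by simp
  ultimately have "z > 0" by linarith
  with \<open>F z = euler_mascheroni\<close> show False
    using F_level_unique[of 0 z euler_mascheroni] by (auto simp: F_0)
qed

theorem theorem1:
  shows "strict_mono_on {0..} F"
proof -
  have "inj_on F {0..}"
  proof (rule linorder_inj_onI)
    fix x y :: real assume "x < y" "x \<in> {0..}" "y \<in> {0..}"
    \<comment> \<open>\<open>F_ge\<close> supplies the condition on the level c =
      \<open>F x\<close>.\<close>
    thus "F x \<noteq> F y" using F_level_unique[of x y "F x"] F_ge[of x] by auto
  qed auto
  hence "strict_mono_on {0..} F \<or> strict_antimono_on {0..} F"
    using injective_eq_monotone_map[OF is_interval_ci F_continuous] by simp
  moreover have "\<not> strict_antimono_on {0..} F"
    using F_0_less_F_1 monotone_onD[of "{0..}" "(<)" "(>)" F 0 1] by auto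
  ultimately show ?thesis by blast
qed

end
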